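(* Let $G$ be a partially ordered group with an analytic topological structure $\ll$, let $(X,d)$ be a complete metric space valued in $G$, and let $T: X\to 2^X\setminus\{\emptyset\}$ be a multi-valued $\varphi$-weak contraction on $(X,d)$ (for some mapping $\varphi: X\times X\to G_+$ with $\varphi(x,y)\prec d(x,y)$ whenever $d(x,y)\succ\theta$) which satisfies the C-condition. Then $T$ has a unique endpoint if and only if $T$ has the approximate endpoint property.
   Context: Partially ordered group: an abelian group $G$ (written additively, identity $\theta$, having non-identity elements) with a partial order $\preceq$ such that $a\prec b\Rightarrow a+c\prec b+c$ for all $a,b,c\in G$, where $a\prec b$ means $a\preceq b$ and $a\ne b$. Put $G_+=\{a\in G: a\succeq\theta\}$. Analytic topological structure of $G$: a non-empty binary relation $\ll$ on $G$ such that, for all $a,b,c\in G$: (t1) $a\ll b\Rightarrow a\prec b$; (t2) $a\preceq b$ and $b\ll c$ imply $a\ll c$; (t3) $a\ll b\Rightarrow a+c\ll b+c$; (t4) if $\theta\preceq a$ and $a\ll\varepsilon$ for all $\varepsilon\gg\theta$, then $a=\theta$; (t5) for every $\varepsilon\gg\theta$ there is $\eta\gg\theta$ with $\eta\ll\varepsilon$. Convergence in $G_+$: a sequence $\{a_n\}$ in $G_+$ converges to $a\in G_+$ ($a_n\to a$) if for every $\varepsilon\gg\theta$ there is a natural number $N$ with $\theta\preceq a_n-a\ll\varepsilon$ for all $n>N$. Metric space valued in $G$: a non-empty set $X$ with a map $d:X\times X\to G$ such that $d(x,y)\succeq\theta$, with $d(x,y)=\theta$ iff $x=y$; $d(x,y)=d(y,x)$;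 and $d(x,y)\preceq d(x,z)+d(z,y)$ for all $x,y,z\in X$. A sequence $\{x_n\}$ in $X$ converges to $x\in X$ if $d(x_n,x)\to\theta$; it is Cauchy if for every $\varepsilon\gg\theta$ there is $N$ with $d(x_n,x_m)\ll\varepsilon$ for all $n,m\ge N$; $(X,d)$ is complete if every Cauchy sequence converges. Multi-valued $\varphi$-weak contraction: given $\varphi:X\times X\to G_+$ with $\varphi(x,y)\prec d(x,y)$ whenever $d(x,y)\succ\theta$, a map $T:X\to 2^X\setminus\{\emptyset\}$ such that for all $x\neq y$ in $X$ and all $x'\in Tx$ there exists $\bar y\in Ty$ with $d(x',\bar y)\preceq\varphi(x,y)$. C-condition (for $T$ with its $\varphi$): for any two sequences $\{x_n\},\{y_n\}$ in $X$, if $d(x_n,y_n)-\varphi(x_n,y_n)\to\theta$ then $d(x_n,y_n)\to\theta$. An endpoint of $T$ is a point $x\in X$ with $Tx=\{x\}$. $T$ has the approximate endpoint property if there exist a sequence $\{x_n\}$ in $X$ and a sequence $\{a_n\}$ in $G_+$ with $a_n\to\theta$ such that $d(x_n,x_n')\preceq a_n$ for all $x_n'\in Tx_n$ and all $n\in\mathbb N$. *)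

theory Defs
  imports Main
begin

(* The library class has the non-strict form of translation invariance, which by
   cancellation is the same as the strict form a < b ==> a + c < b + c. *)
class partially_ordered_group = ordered_ab_group_add +
  assumes nontrivial: "\<exists>a. a \<noteq> 0"

locale analytic_topological_structure =
  fixes ll :: "'g::partially_ordered_group \<Rightarrow> 'g \<Rightarrow> bool"  (infix "\<lless>" 50)
  assumes nonempty: "\<exists>a b. a \<lless> b"
    and t1: "a \<lless> b \<Longrightarrow> a < b"
    and t2: "a \<le> b \<Longrightarrow> b \<lless> c \<Longrightarrow> a \<lless> c"
    and t3: "a \<lless> b \<Longrightarrow> a + c \<lless> b + c"
    and t4: "0 \<le> a \<Longrightarrow> (\<And>\<epsilon>. 0 \<lless> \<epsilon> \<Longrightarrow> a \<lless> \<epsilon>) \<Longrightarrow> a = 0"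
    and t5: "0 \<lless> \<epsilon> \<Longrightarrow> \<exists>\<eta>. 0 \<lless> \<eta> \<and> \<eta> \<lless> \<epsilon>"

(* Convergence is only defined for sequences and limits in the positive cone, so
   membership in the cone is part of the predicate. *)
definition converges_to ::
  "('g::partially_ordered_group \<Rightarrow> 'g \<Rightarrow> bool) \<Rightarrow> (nat \<Rightarrow> 'g) \<Rightarrow> 'g \<Rightarrow> bool" where
  "converges_to ll a l \<longleftrightarrow>
     (\<forall>n. 0 \<le> a n) \<and> 0 \<le> l \<and>
     (\<forall>\<epsilon>. ll 0 \<epsilon> \<longrightarrow> (\<exists>N. \<forall>n>N. 0 \<le> a n - l \<and> ll (a n - l) \<epsilon>))"

(* The underlying non-empty set of the metric space is the type 'x. *)
locale group_valued_metric =
  fixes d :: "'x \<Rightarrow> 'x \<Rightarrow> 'g::partially_ordered_group"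
  assumes nonneg: "0 \<le> d x y"
    and zero_iff: "d x y = 0 \<longleftrightarrow> x = y"
    and commute: "d x y = d y x"
    and triangle: "d x y \<le> d x z + d z y"

definition metric_converges_to ::
  "('g::partially_ordered_group \<Rightarrow> 'g \<Rightarrow> bool) \<Rightarrow> ('x \<Rightarrow> 'x \<Rightarrow> 'g) \<Rightarrow> (nat \<Rightarrow> 'x) \<Rightarrow> 'x \<Rightarrow> bool" where
  "metric_converges_to ll d x l \<longleftrightarrow> converges_to ll (\<lambda>n. d (x n) l) 0"

definition metric_Cauchy ::
  "('g::partially_ordered_group \<Rightarrow> 'g \<Rightarrow> bool) \<Rightarrow> ('x \<Rightarrow> 'x \<Rightarrow> 'g) \<Rightarrow> (nat \<Rightarrow> 'x) \<Rightarrow> bool" where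
  "metric_Cauchy ll d x \<longleftrightarrow>
     (\<forall>\<epsilon>. ll 0 \<epsilon> \<longrightarrow> (\<exists>N. \<forall>n\<ge>N. \<forall>m\<ge>N. ll (d (x n) (x m)) \<epsilon>))"

definition metric_complete ::
  "('g::partially_ordered_group \<Rightarrow> 'g \<Rightarrow> bool) \<Rightarrow> ('x \<Rightarrow> 'x \<Rightarrow> 'g) \<Rightarrow> bool" where
  "metric_complete ll d \<longleftrightarrow>
     (\<forall>x. metric_Cauchy ll d x \<longrightarrow> (\<exists>l. metric_converges_to ll d x l))"

locale multivalued_weak_contraction =
  fixes d :: "'x \<Rightarrow> 'x \<Rightarrow> 'g::partially_ordered_group"
    and \<phi> :: "'x \<Rightarrow> 'x \<Rightarrow> 'g"
    and T :: "'x \<Rightarrow> 'x set"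
  assumes phi_nonneg: "0 \<le> \<phi> x y"
    and phi_less: "0 < d x y \<Longrightarrow> \<phi> x y < d x y"
    and T_nonempty: "T x \<noteq> {}"
    and contraction: "x \<noteq> y \<Longrightarrow> x' \<in> T x \<Longrightarrow> \<exists>y'\<in>T y. d x' y' \<le> \<phi> x y"

definition C_condition ::
  "('g::partially_ordered_group \<Rightarrow> 'g \<Rightarrow> bool) \<Rightarrow> ('x \<Rightarrow> 'x \<Rightarrow> 'g) \<Rightarrow> ('x \<Rightarrow> 'x \<Rightarrow> 'g) \<Rightarrow> bool" where
  "C_condition ll d \<phi> \<longleftrightarrow>
     (\<forall>x y. converges_to ll (\<lambda>n. d (x n) (y n) - \<phi> (x n) (y n)) 0 \<longrightarrow>
            converges_to ll (\<lambda>n. d (x n) (y n)) 0)"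

definition endpoint :: "('x \<Rightarrow> 'x set) \<Rightarrow> 'x \<Rightarrow> bool" where
  "endpoint T x \<longleftrightarrow> T x = {x}"

definition approximate_endpoint_property ::
  "('g::partially_ordered_group \<Rightarrow> 'g \<Rightarrow> bool) \<Rightarrow> ('x \<Rightarrow> 'x \<Rightarrow> 'g) \<Rightarrow> ('x \<Rightarrow> 'x set) \<Rightarrow> bool" where
  "approximate_endpoint_property ll d T \<longleftrightarrow>
     (\<exists>x a. (\<forall>n. 0 \<le> a n) \<and> converges_to ll a 0 \<and>
            (\<forall>n. \<forall>x'\<in>T (x n). d (x n) x' \<le> a n))"

end

(* Two endpoints at positive distance would contradict phi < d, and a constant sequence at the
   endpoint is approximate. Conversely, if x n is approximate with bounds a n, then at distinct
   points d (x n) (x m) - phi (x n) (x m) <= a n + a m. If x were not Cauchy, the pairs witnessing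
   this would consist of distinct points, and the C-condition would force their distances to tend
   to 0. At the limit l, every l' in T l satisfies d l l' <= d (x n) l + (d (x n) l + a n), which
   tends to 0, so T l = {l}. *)
theory Submission
  imports Defs
begin

lemma converges_to_0_iff:
  "converges_to ll a 0 \<longleftrightarrow>
     (\<forall>n. 0 \<le> a n) \<and> (\<forall>\<epsilon>. ll 0 \<epsilon> \<longrightarrow> (\<exists>N. \<forall>n>N. ll (a n) \<epsilon>))"
  by (auto simp: converges_to_def)

text \<open>Convergence to 0 constrains every index past some \<open>N\<close>, so
  \<open>k \<le> r k\<close> suffices. Index maps obtained by choice, possibly not monotone, can
  thus be plugged in directly.\<close>

lemma converges_to_0_subseq:
  fixes r :: "nat \<Rightarrow> nat"
  assumes "converges_to ll a 0" and "\<And>k. k \<le> r k"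
  shows "converges_to ll (\<lambda>k. a (r k)) 0"
  using assms unfolding converges_to_0_iff by (meson order_less_le_trans)

context analytic_topological_structure
begin

lemma converges_to_0_mono:
  assumes "converges_to (\<lless>) b 0" and "\<And>n. 0 \<le> a n" and "\<And>n. a n \<le> b n"
  shows "converges_to (\<lless>) a 0"
  using assms t2[OF assms(3)] unfolding converges_to_0_iff by blast

text \<open>A general group offers no halving, so the tolerance is split as
  \<open>\<epsilon> = \<eta> + (\<epsilon> - \<eta>)\<close>. Weakening one relation to
  \<open>\<le>\<close> by \<open>t1\<close> lets \<open>t2\<close> chain the two.\<close>

lemma add_lless:
  assumes "a \<lless> \<eta>" and "b \<lless> \<epsilon> - \<eta>"
  shows "a + b \<lless> \<epsilon>"
proof -
  have "a + b \<le> \<eta> + b"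
    using t1[OF assms(1)] by (simp add: less_imp_le)
  moreover have "\<eta> + b \<lless> \<epsilon>"
    using t3[OF assms(2), of \<eta>] by (simp add: add.commute)
  ultimately show ?thesis
    by (rule t2)
qed

lemma converges_to_0_add:
  assumes a: "converges_to (\<lless>) a 0" and b: "converges_to (\<lless>) b 0"
  shows "converges_to (\<lless>) (\<lambda>n. a n + b n) 0"
  unfolding converges_to_0_iff
proof (intro conjI allI impI)
  show "0 \<le> a n + b n" for n
    using a b by (simp add: converges_to_0_iff)
next
  fix \<epsilon> :: 'g
  assume "0 \<lless> \<epsilon>"
  then obtain \<eta> where \<eta>: "0 \<lless> \<eta>" "\<eta> \<lless> \<epsilon>"
    using t5 by blast
  \<comment> \<open>Translation by \<open>- \<eta>\<close> shows that the second part of the split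
    is an admissible tolerance too.\<close>
  have "0 \<lless> \<epsilon> - \<eta>"
    using t3[OF \<eta>(2), of "- \<eta>"] by simp
  then obtain M N where "\<And>n. n > M \<Longrightarrow> a n \<lless> \<eta>" "\<And>n. n > N \<Longrightarrow> b n \<lless> \<epsilon> - \<eta>"
    using a b \<eta>(1) unfolding converges_to_0_iff by meson
  then show "\<exists>K. \<forall>n>K. a n + b n \<lless> \<epsilon>"
    by (intro exI[of _ "max M N"]) (auto intro: add_lless)
qed

lemma converges_to_0_const_imp_eq_0:
  assumes "converges_to (\<lless>) (\<lambda>n. c) 0"
  shows "c = 0"
  using assms t4[of c] unfolding converges_to_0_iff by blast

end

locale weak_contraction_space =
  analytic_topological_structure ll + group_valued_metric d + multivalued_weak_contraction d \<phi> T
  for ll :: "'g::partially_ordered_group \<Rightarrow> 'g \<Rightarrow> bool"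
    and d :: "'x \<Rightarrow> 'x \<Rightarrow> 'g" and \<phi> :: "'x \<Rightarrow> 'x \<Rightarrow> 'g" and T :: "'x \<Rightarrow> 'x set"
begin

lemma dist_self [simp]: "d x x = 0"
  by (simp add: zero_iff)

lemma phi_less_dist: "x \<noteq> y \<Longrightarrow> \<phi> x y < d x y"
  using phi_less[of x y] nonneg[of x y] zero_iff[of x y] by (simp add: order_less_le)

lemma endpoint_unique:
  assumes "endpoint T x" and "endpoint T y"
  shows "x = y"
proof (rule ccontr)
  assume "x \<noteq> y"
  \<comment> \<open>As \<open>T y\<close> is a singleton, the point that \<open>contraction\<close>
    supplies for \<open>x\<close> can only be \<open>y\<close>.\<close>
  then have "d x y \<le> \<phi> x y"
    using contraction[of x y x] assms by (simp add: endpoint_def)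
  then show False
    using phi_less_dist[OF \<open>x \<noteq> y\<close>] by (simp add: less_le_not_le)
qed

text \<open>The path from \<open>x\<close> to \<open>y\<close> runs through some \<open>x'\<close>
  in \<open>T x\<close> and its partner \<open>y'\<close> in \<open>T y\<close>: the outer legs cost
  at most \<open>a\<close> and \<open>b\<close>, the middle one at most
  \<open>\<phi> x y\<close>.\<close>

lemma dist_minus_phi_le:
  assumes "x \<noteq> y" and "\<And>x'. x' \<in> T x \<Longrightarrow> d x x' \<le> a" and "\<And>y'. y' \<in> T y \<Longrightarrow> d y y' \<le> b"
  shows "d x y - \<phi> x y \<le> a + b"
proof -
  obtain x' where x': "x' \<in> T x"
    using T_nonempty by blast
  obtain y' where y': "y' \<in> T y" "d x' y' \<le> \<phi> x y"
    using contraction[OF assms(1) x'] by blast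
  have "d x y \<le> d x x' + d x' y"
    by (rule triangle)
  also have "\<dots> \<le> d x x' + (d x' y' + d y' y)"
    by (intro add_left_mono triangle)
  also have "\<dots> \<le> a + (\<phi> x y + b)"
    using assms(2)[OF x'] y'(2) assms(3)[OF y'(1)] by (intro add_mono) (simp_all add: commute)
  finally show ?thesis
    by (simp add: diff_le_eq ac_simps)
qed

lemma approximate_sequence_Cauchy:
  assumes C: "C_condition ll d \<phi>" and a: "converges_to ll a 0"
    and x: "\<And>n x'. x' \<in> T (x n) \<Longrightarrow> d (x n) x' \<le> a n"
  shows "metric_Cauchy ll d x"
proof (rule ccontr)
  assume "\<not> metric_Cauchy ll d x"
  then obtain \<epsilon> where \<epsilon>: "ll 0 \<epsilon>"
    and "\<forall>k. \<exists>n m. k \<le> n \<and> k \<le> m \<and> \<not> ll (d (x n) (x m)) \<epsilon>"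
    unfolding metric_Cauchy_def by blast
  then obtain r s where r: "\<And>k. k \<le> r k" and s: "\<And>k. k \<le> s k"
    and far: "\<And>k. \<not> ll (d (x (r k)) (x (s k))) \<epsilon>"
    unfolding choice_iff by blast
  (* The value of phi on the diagonal is arbitrary, so distinctness is needed for
     d - phi to lie in the positive cone. *)
  have neq: "x (r k) \<noteq> x (s k)" for k
    using far[of k] \<epsilon> by auto
  have "converges_to ll (\<lambda>k. a (r k) + a (s k)) 0"
    using converges_to_0_subseq[OF a r] converges_to_0_subseq[OF a s] by (rule converges_to_0_add)
  then have "converges_to ll (\<lambda>k. d (x (r k)) (x (s k)) - \<phi> (x (r k)) (x (s k))) 0"
    by (rule converges_to_0_mono)
      (use neq x in \<open>auto intro: dist_minus_phi_le less_imp_le[OF phi_less_dist]\<close>)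
  then have "converges_to ll (\<lambda>k. d (x (r k)) (x (s k))) 0"
    using C[unfolded C_condition_def, rule_format, of "\<lambda>k. x (r k)" "\<lambda>k. x (s k)"] by simp
  \<comment> \<open>Since \<open>far\<close> holds at every index, a single index past the threshold
    for \<open>\<epsilon>\<close> gives the contradiction.\<close>
  then show False
    using \<epsilon> far unfolding converges_to_0_iff by (meson lessI)
qed

text \<open>Here \<open>contraction\<close> is applied from \<open>y\<close> to \<open>x\<close>, so
  that \<open>y'\<close> stays arbitrary and only its partner in \<open>T x\<close> is chosen. This
  bounds all of \<open>T y\<close> at once.\<close>

lemma dist_image_le:
  assumes "y' \<in> T y" and "\<And>x'. x' \<in> T x \<Longrightarrow> d x x' \<le> a"
  shows "d y y' \<le> d x y + (d x y + a)"
proof (cases "x = y")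
  \<comment> \<open>\<open>contraction\<close> speaks of distinct points only; for equal ones the
    bound at \<open>x\<close> applies to \<open>y'\<close> itself.\<close>
  case True
  then show ?thesis
    using assms by simp
next
  case False
  then obtain x' where x': "x' \<in> T x" "d y' x' \<le> \<phi> y x"
    using contraction[of y x y'] assms(1) by auto
  have "\<phi> y x \<le> d x y"
    using phi_less_dist[of y x] False by (simp add: commute less_imp_le)
  then have "d x' y' \<le> d x y"
    using x'(2) by (simp add: commute)
  have "d y y' \<le> d y x + d x y'"
    by (rule triangle)
  also have "\<dots> \<le> d y x + (d x x' + d x' y')"
    by (intro add_left_mono triangle)
  also have "\<dots> \<le> d x y + (a + d x y)"
    using \<open>d x' y' \<le> d x y\<close> assms(2)[OF x'(1)] by (intro add_mono) (simp_all add: commute)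
  finally show ?thesis
    by (simp add: ac_simps)
qed

lemma approximate_sequence_limit_endpoint:
  assumes a: "converges_to ll a 0"
    and x: "\<And>n x'. x' \<in> T (x n) \<Longrightarrow> d (x n) x' \<le> a n"
    and lim: "metric_converges_to ll d x l"
  shows "endpoint T l"
proof -
  have "l' = l" if l': "l' \<in> T l" for l'
  proof -
    \<comment> \<open>This sequence dominates the constant \<open>d l l'\<close>, and a constant
      that converges to 0 is 0 by \<open>t4\<close>.\<close>
    have "converges_to ll (\<lambda>n. d (x n) l + (d (x n) l + a n)) 0"
      using lim a unfolding metric_converges_to_def by (intro converges_to_0_add)
    then have "converges_to ll (\<lambda>n. d l l') 0"
      by (rule converges_to_0_mono) (use nonneg l' x in \<open>auto intro: dist_image_le\<close>)
    then show ?thesis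
      using converges_to_0_const_imp_eq_0[of "d l l'"] zero_iff[of l l'] by simp
  qed
  then show ?thesis
    using T_nonempty[of l] unfolding endpoint_def by blast
qed

lemma endpoint_imp_approximate_endpoint_property:
  assumes "endpoint T x"
  shows "approximate_endpoint_property ll d T"
  unfolding approximate_endpoint_property_def
  by (rule exI[of _ "\<lambda>n. x"], rule exI[of _ "\<lambda>n. 0"])
    (use assms in \<open>auto simp: endpoint_def converges_to_0_iff\<close>)

end

theorem theorem3p1:
  fixes ll :: "'g::partially_ordered_group \<Rightarrow> 'g \<Rightarrow> bool"
    and d :: "'x \<Rightarrow> 'x \<Rightarrow> 'g"
    and \<phi> :: "'x \<Rightarrow> 'x \<Rightarrow> 'g"
    and T :: "'x \<Rightarrow> 'x set"
  assumes "analytic_topological_structure ll"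
    and "group_valued_metric d"
    and "metric_complete ll d"
    and "multivalued_weak_contraction d \<phi> T"
    and "C_condition ll d \<phi>"
  shows "(\<exists>!x. endpoint T x) \<longleftrightarrow> approximate_endpoint_property ll d T"
proof -
  interpret weak_contraction_space ll d \<phi> T
    using assms by (intro weak_contraction_space.intro)
  show ?thesis
  proof
    assume "\<exists>!x. endpoint T x"
    then show "approximate_endpoint_property ll d T"
      using endpoint_imp_approximate_endpoint_property by blast
  next
    assume "approximate_endpoint_property ll d T"
    then obtain x a where a: "converges_to ll a 0"
      and x: "\<And>n x'. x' \<in> T (x n) \<Longrightarrow> d (x n) x' \<le> a n"
      unfolding approximate_endpoint_property_def by blast
    have "metric_Cauchy ll d x"
      using assms(5) a x by (rule approximate_sequence_Cauchy)
    then obtain l where "metric_converges_to ll d x l"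
      using assms(3) unfolding metric_complete_def by blast
    then have "endpoint T l"
      using approximate_sequence_limit_endpoint[OF a x] by blast
    then show "\<exists>!x. endpoint T x"
      using endpoint_unique by blast
  qed
qed

end
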